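(* Let $\lambda_g>0$, $s=1/\sqrt{\lambda_g}$, let $\Phi_g$ be the random shifted square grid of intensity $\lambda_g$, and let $R_g=\inf_{X\in\Phi_g}\|X\|$ be the distance from the origin to the nearest point of $\Phi_g$. Then the CDF of $R_g$ is $$\mathbf{P}(R_g<r)=\begin{cases}0&\text{if } r<0,\\ \dfrac{\pi r^2}{s^2}&\text{if }0\le r\le \frac s2,\\[2mm] 2\dfrac{r^2}{s^2}\left(\dfrac{\pi-4\arccos\left(\frac{s}{2r}\right)}{2}\right)+\sqrt{\dfrac{4r^2}{s^2}-1}&\text{if }\frac s2<r\le\frac{s}{\sqrt2},\\ 1&\text{if }r>\frac{s}{\sqrt2},\end{cases}$$ and its PDF is $$f_{R_g}(r)=\begin{cases}2\pi r s^{-2}&\text{if }0\le r\le\frac s2,\\ 2\pi r s^{-2}-\dfrac{8r}{s^2}\arccos\left(\dfrac{s}{2r}\right)&\text{if }\frac s2<r\le\frac{s}{\sqrt2},\\ 0&\text{otherwise.}\end{cases}$$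
   Context: Random shifted grid: with $U$ uniform on $[-s/2,s/2]^2$, $\Phi_g=\{sk+U:k\in\mathbb{Z}^2\}$ (a single common shift $U$ for all points). *)

theory Defs
  imports "HOL-Probability.Probability"
begin

(* The norm of the product type real \<times> real is the Euclidean one (norm_Pair). *)

definition shifted_grid :: "real \<Rightarrow> real \<times> real \<Rightarrow> (real \<times> real) set" where
  "shifted_grid s u = {s *\<^sub>R (real_of_int i, real_of_int j) + u | i j. True}"

definition nearest_dist :: "(real \<times> real) set \<Rightarrow> real" where
  "nearest_dist S = (INF x\<in>S. norm x)"

definition centred_square :: "real \<Rightarrow> (real \<times> real) set" where
  "centred_square s = {-s/2..s/2} \<times> {-s/2..s/2}"

end

theory Submission
  imports Defs
begin

text \<open>
  Shifting a point of the centred square by a grid vector cannot bring either coordinate closer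
  to zero, so \<open>R\<close> equals \<open>norm U\<close> almost surely and its CDF at \<open>r\<close> is the area of the square
  intersected with the disc of radius \<open>r\<close>, divided by \<open>s\<^sup>2\<close>. When the disc sticks out of the square
  but does not contain it, the area is found by slicing. The density is the derivative of the CDF
  away from the two breakpoints; continuity of the CDF there suffices for the fundamental theorem
  of calculus.
\<close>

section \<open>Nearest grid point and measurability of its distance\<close>

text \<open>The infimum is attained at index (0, 0). On the boundary of the square several grid
  points tie, but their common norm is still \<open>norm u\<close>, so the closed square causes no
  trouble.\<close>

lemma nearest_dist_shifted_grid:
  assumes "s > 0" and "u \<in> centred_square s"
  shows "nearest_dist (shifted_grid s u) = norm u"
  unfolding nearest_dist_def
proof (rule cInf_eq_minimum)
  have "u = s *\<^sub>R (real_of_int 0, real_of_int 0) + u"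
    by (simp add: zero_prod_def[symmetric])
  then show "norm u \<in> norm ` shifted_grid s u"
    unfolding shifted_grid_def by blast
next
  fix z assume "z \<in> norm ` shifted_grid s u"
  then obtain i j where z: "z = norm (s *\<^sub>R (real_of_int i, real_of_int j) + u)"
    by (auto simp: shifted_grid_def)
  obtain x y where u: "u = (x, y)" by (cases u)
  \<comment> \<open>A nonzero multiple of \<open>s\<close> has modulus at least \<open>s\<close>, so
    adding it to \<open>t\<close> leaves at least \<open>s - \<bar>t\<bar>\<close>, which is at
    least \<open>\<bar>t\<bar>\<close> as \<open>\<bar>t\<bar> \<le> s/2\<close>.\<close>
  have coord: "\<bar>t\<bar> \<le> \<bar>s * real_of_int k + t\<bar>" if "-s/2 \<le> t" "t \<le> s/2" for t k
  proof (cases "k = 0")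
    case False
    then have "1 \<le> \<bar>real_of_int k\<bar>" by linarith
    then have "s \<le> \<bar>s * real_of_int k\<bar>"
      using \<open>s > 0\<close> by (simp add: abs_mult)
    then show ?thesis using that by linarith
  qed simp
  have "\<bar>x\<bar> \<le> \<bar>s * i + x\<bar>" "\<bar>y\<bar> \<le> \<bar>s * j + y\<bar>"
    using assms(2) by (auto simp: u centred_square_def intro!: coord)
  then show "norm u \<le> z"
    by (auto simp: z u norm_Pair intro!: add_mono abs_le_square_iff[THEN iffD1])
qed

text \<open>Reindexing by integer pairs turns the infimum over a set that depends on
  \<open>u\<close> into an infimum of countably many functions continuous in
  \<open>u\<close>.\<close>

lemma borel_measurable_nearest_dist [measurable]:
  "(\<lambda>u. nearest_dist (shifted_grid s u)) \<in> borel_measurable borel"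
proof -
  have "norm ` shifted_grid s u = (\<lambda>(i, j). norm (s *\<^sub>R (real_of_int i, real_of_int j) + u)) ` UNIV" for u
    by (force simp: shifted_grid_def)
  then have eq: "nearest_dist (shifted_grid s u) =
      (INF k. norm (s *\<^sub>R (real_of_int (fst k), real_of_int (snd k)) + u))" for u
    by (simp add: nearest_dist_def case_prod_beta)
  show ?thesis
    unfolding eq
    by (intro borel_measurable_cINF_real countableI_type borel_measurable_continuous_onI
        continuous_intros)
qed

section \<open>Area of the intersection of a square and a disc\<close>

text \<open>Spheres are null sets. Hence one area formula serves both the strict inequality in the
  CDF and the closed half-lines that determine the law.\<close>

lemma emeasure_ball_eq_cball:
  fixes c :: "'a::euclidean_space"
  assumes [measurable]: "A \<in> sets borel"
  shows "emeasure lborel (A \<inter> ball c r) = emeasure lborel (A \<inter> cball c r)"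
proof -
  have "sphere c r \<in> null_sets lborel"
    using negligible_sphere[of c r]
    by (auto simp: null_sets_completion_iff negligible_iff_null_sets)
  then have "A \<inter> sphere c r \<in> null_sets lborel"
    by (rule null_set_Int1) simp
  then have "emeasure lborel (A \<inter> ball c r \<union> A \<inter> sphere c r) = emeasure lborel (A \<inter> ball c r)"
    by (intro emeasure_Un_null_set) auto
  moreover have "A \<inter> ball c r \<union> A \<inter> sphere c r = A \<inter> cball c r" by auto
  ultimately show ?thesis by simp
qed

text \<open>The integrand is the chord length at abscissa \<open>t\<close>; \<open>t * sqrt
  (r\<^sup>2 - t\<^sup>2) + r\<^sup>2 * arcsin (t / r)\<close> is an antiderivative. The bounds stay
  strictly between \<open>-r\<close> and \<open>r\<close>, where \<open>sqrt\<close> and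
  \<open>arcsin\<close> are differentiable.\<close>

lemma has_integral_circle_segment:
  fixes r :: real
  assumes "0 < r" "-r < x" "x \<le> y" "y < r"
  shows "((\<lambda>t. 2 * sqrt (r\<^sup>2 - t\<^sup>2)) has_integral
     (y * sqrt (r\<^sup>2 - y\<^sup>2) + r\<^sup>2 * arcsin (y / r) - (x * sqrt (r\<^sup>2 - x\<^sup>2) + r\<^sup>2 * arcsin (x / r)))) {x..y}"
proof (rule fundamental_theorem_of_calculus[OF \<open>x \<le> y\<close>])
  fix t assume "t \<in> {x..y}"
  then have t: "-r < t" "t < r" using assms by auto
  then have "\<bar>t\<bar> < \<bar>r\<bar>" by linarith
  then have pos: "r\<^sup>2 - t\<^sup>2 > 0"
    using power_strict_mono[of "\<bar>t\<bar>" "\<bar>r\<bar>" 2] by simp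
  define w where "w = sqrt (r\<^sup>2 - t\<^sup>2)"
  have w: "w > 0" "w\<^sup>2 = r\<^sup>2 - t\<^sup>2" using pos by (auto simp: w_def)
  have "1 - (t / r)\<^sup>2 = (w / r)\<^sup>2"
    using \<open>0 < r\<close> w by (simp add: field_simps)
  then have s: "sqrt (1 - (t / r)\<^sup>2) = w / r"
    using \<open>0 < r\<close> w by simp
  have "((\<lambda>t. t * sqrt (r\<^sup>2 - t\<^sup>2) + r\<^sup>2 * arcsin (t / r)) has_real_derivative
      (w + t * (- (2 * t) * (inverse w / 2)) + r\<^sup>2 * (inverse (w / r) * (1 / r)))) (at t)"
    unfolding s[symmetric] unfolding w_def
    by (rule derivative_eq_intros refl | use t \<open>0 < r\<close> pos in \<open>simp add: field_simps\<close>)+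
  \<comment> \<open>As \<open>w\<^sup>2 = r\<^sup>2 - t\<^sup>2\<close>, the terms
    \<open>- t\<^sup>2 / w\<close> and \<open>r\<^sup>2 / w\<close> add up to
    \<open>w\<close>.\<close>
  also have "w + t * (- (2 * t) * (inverse w / 2)) + r\<^sup>2 * (inverse (w / r) * (1 / r)) = 2 * w"
    using w \<open>0 < r\<close> by (simp add: field_simps power2_eq_square)
  finally show "((\<lambda>t. t * sqrt (r\<^sup>2 - t\<^sup>2) + r\<^sup>2 * arcsin (t / r)) has_vector_derivative
      2 * sqrt (r\<^sup>2 - t\<^sup>2)) (at t within {x..y})"
    unfolding w_def
    by (metis has_real_derivative_iff_has_vector_derivative has_vector_derivative_at_within)
qed

text \<open>The slice at abscissa \<open>x\<close> is an interval whose half-length is the smaller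
  of \<open>a\<close> and the height of the circle. Integrating the slice lengths splits the area
  into a central rectangle and two outer slabs of the disc.\<close>

lemma emeasure_square_Int_cball:
  assumes "0 < a" "a < r" "r \<le> sqrt 2 * a"
  shows "emeasure lborel (({-a..a} \<times> {-a..a}) \<inter> cball (0::real \<times> real) r) =
     ennreal (4 * a * sqrt (r\<^sup>2 - a\<^sup>2) + r\<^sup>2 * (pi - 4 * arccos (a / r)))"
    (is "emeasure lborel ?A = ennreal ?I")
proof -
  \<comment> \<open>The circle meets the horizontal sides of the square at the abscissas
    \<open>c\<close> and \<open>-c\<close>.\<close>
  define c where "c = sqrt (r\<^sup>2 - a\<^sup>2)"
  have r: "0 < r" using assms by simp
  have "a\<^sup>2 < r\<^sup>2" using assms by (simp add: power_strict_mono)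
  then have c: "0 < c" "c\<^sup>2 = r\<^sup>2 - a\<^sup>2" by (auto simp: c_def)
  \<comment> \<open>The bound by the half-diagonal yields \<open>c \<le> a\<close>, so both split
    points lie in \<open>{-a..a}\<close>.\<close>
  have "r\<^sup>2 \<le> (sqrt 2 * a)\<^sup>2" using assms by (intro power_mono) auto
  then have "c\<^sup>2 \<le> a\<^sup>2" using c by (simp add: power_mult_distrib)
  then have ca: "c \<le> a" using assms by (auto intro: power2_le_imp_le)
  have sqrt_c: "sqrt (r\<^sup>2 - c\<^sup>2) = a" using c assms by simp
  define h where "h = (\<lambda>x. 2 * min a (sqrt (r\<^sup>2 - x\<^sup>2)))"
  have le: "x\<^sup>2 \<le> r\<^sup>2" if "x \<in> {-a..a}" for x
    using that assms by (intro power2_le_iff_abs_le[THEN iffD2]) auto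
  have slice: "emeasure lborel (Pair x -` ?A) = ennreal (h x) * indicator {-a..a} x" for x
  proof (cases "x \<in> {-a..a}")
    case True
    have "Pair x -` ?A = {- min a (sqrt (r\<^sup>2 - x\<^sup>2))..min a (sqrt (r\<^sup>2 - x\<^sup>2))}"
    proof (intro set_eqI)
      fix y
      have "sqrt (x\<^sup>2 + y\<^sup>2) \<le> r \<longleftrightarrow> x\<^sup>2 + y\<^sup>2 \<le> r\<^sup>2"
        using r by (metis abs_of_pos real_sqrt_abs real_sqrt_le_iff)
      also have "\<dots> \<longleftrightarrow> y\<^sup>2 \<le> r\<^sup>2 - x\<^sup>2" by linarith
      also have "\<dots> \<longleftrightarrow> \<bar>y\<bar> \<le> sqrt (r\<^sup>2 - x\<^sup>2)"
        by (metis real_sqrt_abs real_sqrt_le_iff)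
      finally have "sqrt (x\<^sup>2 + y\<^sup>2) \<le> r \<longleftrightarrow> \<bar>y\<bar> \<le> sqrt (r\<^sup>2 - x\<^sup>2)" .
      then show "y \<in> Pair x -` ?A \<longleftrightarrow>
          y \<in> {- min a (sqrt (r\<^sup>2 - x\<^sup>2))..min a (sqrt (r\<^sup>2 - x\<^sup>2))}"
        using True by (auto simp: norm_Pair)
    qed
    moreover have "0 \<le> min a (sqrt (r\<^sup>2 - x\<^sup>2))"
      using assms le[OF True] by simp
    ultimately show ?thesis using True by (simp only: h_def emeasure_lborel_Icc) simp
  qed auto
  \<comment> \<open>Where \<open>\<bar>t\<bar> \<ge> c\<close> the circle is no higher than
    \<open>a\<close>, so the minimum in \<open>h\<close> is the circle. Stated for general bounds to
    cover both the left and the right slab.\<close>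
  have outer: "(h has_integral (y * sqrt (r\<^sup>2 - y\<^sup>2) + r\<^sup>2 * arcsin (y / r)
      - (x * sqrt (r\<^sup>2 - x\<^sup>2) + r\<^sup>2 * arcsin (x / r)))) {x..y}"
    if "-a \<le> x" "x \<le> y" "y \<le> a" and far: "\<And>t. t \<in> {x..y} \<Longrightarrow> c \<le> \<bar>t\<bar>" for x y
  proof (rule has_integral_eq[OF _ has_integral_circle_segment[OF r]])
    fix t assume "t \<in> {x..y}"
    then have "c\<^sup>2 \<le> t\<^sup>2" using far c by (metis abs_of_pos abs_le_square_iff)
    then have "sqrt (r\<^sup>2 - t\<^sup>2) \<le> sqrt (r\<^sup>2 - c\<^sup>2)" by simp
    then show "2 * sqrt (r\<^sup>2 - t\<^sup>2) = h t" by (simp add: h_def sqrt_c)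
  qed (use that assms in auto)
  have inner: "(h has_integral (4 * a * c)) {-c..c}"
  proof -
    have "((\<lambda>_. 2 * a) has_integral (4 * a * c)) {-c..c}"
      using has_integral_const_real[of "2 * a" "-c" c] c by (simp add: algebra_simps)
    then show ?thesis
    proof (rule has_integral_eq[rotated])
      fix t assume "t \<in> {-c..c}"
      then have "t\<^sup>2 \<le> c\<^sup>2" by (intro power2_le_iff_abs_le[THEN iffD2]) (use c in auto)
      then have "sqrt (r\<^sup>2 - c\<^sup>2) \<le> sqrt (r\<^sup>2 - t\<^sup>2)" by simp
      then show "2 * a = h t" by (simp add: h_def sqrt_c)
    qed
  qed
  \<comment> \<open>\<open>a / r\<close> and \<open>c / r\<close> are cosine and sine of one angle,
    so every arcsine can be expressed by \<open>arccos (a / r)\<close>.\<close>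
  have arcs: "arcsin (a / r) = pi / 2 - arccos (a / r)" "arcsin (c / r) = arccos (a / r)"
  proof -
    have ar: "0 \<le> a / r" "a / r \<le> 1" using assms by auto
    then show "arcsin (a / r) = pi / 2 - arccos (a / r)"
      by (intro arcsin_arccos_eq) auto
    have "1 - (a / r)\<^sup>2 = (c / r)\<^sup>2" using c r by (simp add: field_simps)
    then have "sqrt (1 - (a / r)\<^sup>2) = c / r" using c r by simp
    with arccos_arcsin_sqrt_pos[OF ar] show "arcsin (c / r) = arccos (a / r)" by simp
  qed
  have arcm: "arcsin (- (t / r)) = - arcsin (t / r)" if "0 \<le> t" "t \<le> a" for t
    using that assms by (intro arcsin_minus) (auto simp: field_simps)
  have "(h has_integral ?I) {-a..a}"
  proof -
    have "(h has_integral (((- c) * sqrt (r\<^sup>2 - (- c)\<^sup>2) + r\<^sup>2 * arcsin ((- c) / r)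
        - ((- a) * sqrt (r\<^sup>2 - (- a)\<^sup>2) + r\<^sup>2 * arcsin ((- a) / r))) + 4 * a * c
       + (a * sqrt (r\<^sup>2 - a\<^sup>2) + r\<^sup>2 * arcsin (a / r)
        - (c * sqrt (r\<^sup>2 - c\<^sup>2) + r\<^sup>2 * arcsin (c / r))))) {-a..a}"
      by (rule has_integral_combine[OF _ _ has_integral_combine[OF _ _ outer inner] outer])
        (use c ca assms in auto)
    \<comment> \<open>In each slab the products \<open>a * c\<close> cancel and
      \<open>r\<^sup>2 * (pi / 2 - 2 * arccos (a / r))\<close> remains; the rectangle contributes
      \<open>4 * a * c\<close>.\<close>
    also have "(((- c) * sqrt (r\<^sup>2 - (- c)\<^sup>2) + r\<^sup>2 * arcsin ((- c) / r)
        - ((- a) * sqrt (r\<^sup>2 - (- a)\<^sup>2) + r\<^sup>2 * arcsin ((- a) / r))) + 4 * a * c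
       + (a * sqrt (r\<^sup>2 - a\<^sup>2) + r\<^sup>2 * arcsin (a / r)
        - (c * sqrt (r\<^sup>2 - c\<^sup>2) + r\<^sup>2 * arcsin (c / r)))) = ?I"
      using c ca assms
      by (simp add: arcm sqrt_c arcs c_def[symmetric] algebra_simps)
    finally show ?thesis .
  qed
  then have "(\<integral>\<^sup>+x. ennreal (h x) * indicator {-a..a} x \<partial>lborel) = ennreal ?I"
    by (intro nn_integral_has_integral_lebesgue') (use assms le in \<open>auto simp: h_def\<close>)
  moreover have "emeasure lborel ?A = (\<integral>\<^sup>+x. emeasure lborel (Pair x -` ?A) \<partial>lborel)"
    unfolding lborel_prod[symmetric]
    by (intro lborel.emeasure_pair_measure_alt)
       (simp only: lborel_prod sets_lborel, intro borel_closed closed_Int closed_Times, simp_all)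
  ultimately show ?thesis by (simp only: slice)
qed

section \<open>The distribution function as a normalised area\<close>

lemma half_less_divide_sqrt2: "0 < s \<Longrightarrow> s / 2 < s / sqrt 2"
  using sqrt2_less_2 by (intro divide_strict_left_mono) auto

definition grid_dist_cdf :: "real \<Rightarrow> real \<Rightarrow> real" where
  "grid_dist_cdf s r =
     (if r < 0 then 0
      else if r \<le> s / 2 then pi * r\<^sup>2 / s\<^sup>2
      else if r \<le> s / sqrt 2
        then 2 * (r\<^sup>2 / s\<^sup>2) * ((pi - 4 * arccos (s / (2 * r))) / 2) + sqrt (4 * r\<^sup>2 / s\<^sup>2 - 1)
      else 1)"

definition grid_dist_pdf :: "real \<Rightarrow> real \<Rightarrow> real" where
  "grid_dist_pdf s r =
     (if 0 \<le> r \<and> r \<le> s / 2 then 2 * pi * r / s\<^sup>2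
      else if s / 2 < r \<and> r \<le> s / sqrt 2
        then 2 * pi * r / s\<^sup>2 - 8 * r / s\<^sup>2 * arccos (s / (2 * r))
      else 0)"

lemma emeasure_centred_square: "s > 0 \<Longrightarrow> emeasure lborel (centred_square s) = ennreal (s\<^sup>2)"
  by (simp add: centred_square_def lborel_prod[symmetric] lborel.emeasure_pair_measure_Times
      ennreal_mult'[symmetric] power2_eq_square)

text \<open>The four branches correspond to an empty disc, a disc inside the square, a disc cut by
  the sides, and a disc containing the square.\<close>

lemma emeasure_centred_square_Int_cball:
  assumes "s > 0"
  shows "emeasure lborel (centred_square s \<inter> cball 0 r) = ennreal (s\<^sup>2 * grid_dist_cdf s r)"
proof -
  have sq: "centred_square s = {-(s/2)..s/2} \<times> {-(s/2)..s/2}"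
    by (simp add: centred_square_def)
  note half = half_less_divide_sqrt2[OF assms]
  consider "r < 0" | "0 \<le> r" "r \<le> s / 2" | "s / 2 < r" "r \<le> s / sqrt 2" | "s / sqrt 2 < r"
    by linarith
  then show ?thesis
  proof cases
    case 1
    then show ?thesis by (simp add: grid_dist_cdf_def)
  next
    case 2
    have "cball 0 r \<subseteq> centred_square s"
    proof (rule subsetI)
      fix p :: "real \<times> real" assume "p \<in> cball 0 r"
      moreover obtain x y where p: "p = (x, y)" by (cases p)
      ultimately have "sqrt (x\<^sup>2 + y\<^sup>2) \<le> r" by (simp add: norm_Pair)
      moreover have "\<bar>x\<bar> \<le> sqrt (x\<^sup>2 + y\<^sup>2)" "\<bar>y\<bar> \<le> sqrt (x\<^sup>2 + y\<^sup>2)"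
        by (auto intro: real_le_rsqrt)
      ultimately have "\<bar>x\<bar> \<le> s / 2" "\<bar>y\<bar> \<le> s / 2"
        using 2 by linarith+
      then show "p \<in> centred_square s" by (auto simp: p sq abs_le_iff)
    qed
    then have "centred_square s \<inter> cball 0 r = cball 0 r" by auto
    then show ?thesis
      using 2 assms by (simp add: emeasure_cball unit_ball_vol_2 grid_dist_cdf_def power2_eq_square)
  next
    case 3
    have s2: "s / sqrt 2 = sqrt 2 * (s / 2)"
      by (simp add: field_simps)
    \<comment> \<open>Extracting the factor \<open>2 / s\<close> from the root matches the CDF with
      the sliced area for \<open>a = s/2\<close>.\<close>
    have "sqrt (4 * r\<^sup>2 / s\<^sup>2 - 1) = 2 * sqrt (r\<^sup>2 - (s/2)\<^sup>2) / s"
    proof -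
      have "4 * r\<^sup>2 / s\<^sup>2 - 1 = (4 * (r\<^sup>2 - (s/2)\<^sup>2)) / s\<^sup>2"
        using assms by (simp add: field_simps)
      then show ?thesis
        using assms by (simp only: real_sqrt_divide real_sqrt_mult real_sqrt_four) simp
    qed
    then have "s\<^sup>2 * grid_dist_cdf s r =
        4 * (s/2) * sqrt (r\<^sup>2 - (s/2)\<^sup>2) + r\<^sup>2 * (pi - 4 * arccos ((s/2) / r))"
      using 3 assms by (simp add: grid_dist_cdf_def field_simps power2_eq_square)
    moreover have "r \<le> sqrt 2 * (s / 2)" using 3 s2 by simp
    ultimately show ?thesis
      unfolding sq using emeasure_square_Int_cball[of "s/2" r] 3 assms by simp
  next
    case 4
    \<comment> \<open>The corners are the farthest points of the square, at distance
      \<open>s / sqrt 2\<close>.\<close>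
    have "centred_square s \<subseteq> cball 0 r"
    proof (rule subsetI)
      fix p assume "p \<in> centred_square s"
      moreover obtain x y where p: "p = (x, y)" by (cases p)
      ultimately have "\<bar>x\<bar> \<le> s / 2" "\<bar>y\<bar> \<le> s / 2" by (auto simp: sq)
      then have "x\<^sup>2 \<le> (s/2)\<^sup>2" "y\<^sup>2 \<le> (s/2)\<^sup>2"
        using assms by (auto intro!: abs_le_square_iff[THEN iffD1])
      then have "x\<^sup>2 + y\<^sup>2 \<le> s\<^sup>2 / 2" by (simp add: power_divide)
      then have "sqrt (x\<^sup>2 + y\<^sup>2) \<le> sqrt (s\<^sup>2 / 2)" by simp
      also have "\<dots> = s / sqrt 2" using assms by (simp add: real_sqrt_divide)
      finally show "p \<in> cball 0 r" using 4 by (simp add: p norm_Pair)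
    qed
    then have "centred_square s \<inter> cball 0 r = centred_square s" by auto
    moreover have "\<not> r < 0" "\<not> r \<le> s / 2" "\<not> r \<le> s / sqrt 2"
      using 4 half assms by linarith+
    ultimately show ?thesis
      using assms by (simp only: emeasure_centred_square grid_dist_cdf_def if_False mult_1_right)
  qed
qed

section \<open>The density: sign, measurability and integral\<close>

text \<open>This is the angle at the upper breakpoint: \<open>s / (2 * r)\<close> equals
  \<open>sqrt 2 / 2\<close> for \<open>r = s / sqrt 2\<close>.\<close>

lemma arccos_sqrt2_half: "arccos (sqrt 2 / 2) = pi / 4"
  by (rule arccos_unique) (auto simp: cos_45)

text \<open>On the middle branch \<open>s / (2 * r)\<close> is at least \<open>sqrt 2 / 2\<close>.
  As \<open>arccos\<close> decreases, its value is at most \<open>pi / 4\<close>, so the subtracted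
  term never exceeds \<open>2 * pi * r / s\<^sup>2\<close>.\<close>

lemma grid_dist_pdf_nonneg:
  assumes "s > 0"
  shows "0 \<le> grid_dist_pdf s r"
proof (cases "s / 2 < r \<and> r \<le> s / sqrt 2")
  case True
  then have r: "0 < r" using assms by (smt (verit) half_gt_zero)
  have "arccos (s / (2 * r)) \<le> arccos (sqrt 2 / 2)"
  proof (subst arccos_le_mono)
    show "\<bar>s / (2 * r)\<bar> \<le> 1" using True r assms by (simp add: field_simps)
    show "\<bar>sqrt 2 / 2\<bar> \<le> 1" using sqrt2_less_2 by simp
    have "r * sqrt 2 \<le> s" using True by (simp add: field_simps)
    then show "sqrt 2 / 2 \<le> s / (2 * r)" using r by (simp add: field_simps)
  qed
  also have "\<dots> = pi / 4" by (rule arccos_sqrt2_half)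
  finally have "8 * r / s\<^sup>2 * arccos (s / (2 * r)) \<le> 8 * r / s\<^sup>2 * (pi / 4)"
    using r by (intro mult_left_mono) auto
  then show ?thesis using True by (simp add: grid_dist_pdf_def)
qed (use assms in \<open>auto simp: grid_dist_pdf_def\<close>)

lemma borel_measurable_grid_dist_pdf:
  assumes "s > 0"
  shows "grid_dist_pdf s \<in> borel_measurable borel"
proof -
  \<comment> \<open>\<open>arccos\<close> is unspecified outside \<open>{-1..1}\<close>, so its argument is clamped to that interval.\<close>
  define h :: "real \<Rightarrow> real" where "h = (\<lambda>y. arccos (max (-1) (min 1 y)))"
  have "continuous_on UNIV h"
    unfolding h_def by (intro continuous_intros) auto
  then have [measurable]: "h \<in> borel_measurable borel"
    by (rule borel_measurable_continuous_onI)
  have "arccos (s / (2 * r)) = h (s / (2 * r))" if "s / 2 < r" for r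
  proof -
    have "0 < r" using that assms by (smt (verit) half_gt_zero)
    then have "0 \<le> s / (2 * r)" "s / (2 * r) \<le> 1" using that assms by (auto simp: field_simps)
    then show ?thesis by (simp add: h_def)
  qed
  then have "grid_dist_pdf s = (\<lambda>r. if 0 \<le> r \<and> r \<le> s / 2 then 2 * pi * r / s\<^sup>2
      else if s / 2 < r \<and> r \<le> s / sqrt 2
        then 2 * pi * r / s\<^sup>2 - 8 * r / s\<^sup>2 * h (s / (2 * r))
      else 0)"
    by (auto simp: grid_dist_pdf_def)
  then show ?thesis by simp
qed

text \<open>Each branch is integrated separately, and the pieces glue because neighbouring branches
  of the CDF agree at the breakpoints. The CDF vanishes at 0, so no constant appears.\<close>

lemma has_integral_grid_dist_pdf:
  assumes s: "s > 0" and "0 \<le> r"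
  shows "(grid_dist_pdf s has_integral grid_dist_cdf s r) {0..r}"
proof -
  define G where "G = (\<lambda>r. 2 * (r\<^sup>2 / s\<^sup>2) * ((pi - 4 * arccos (s / (2 * r))) / 2) + sqrt (4 * r\<^sup>2 / s\<^sup>2 - 1))"
  note half = half_less_divide_sqrt2[OF s]
  have I1: "(grid_dist_pdf s has_integral (pi * b\<^sup>2 / s\<^sup>2 - pi * 0\<^sup>2 / s\<^sup>2)) {0..b}"
    if "0 \<le> b" "b \<le> s / 2" for b
  proof (rule fundamental_theorem_of_calculus_interior[OF \<open>0 \<le> b\<close>])
    fix x assume "x \<in> {0<..<b}"
    then have "grid_dist_pdf s x = pi * (2 * x) / s\<^sup>2" using that by (simp add: grid_dist_pdf_def)
    then show "((\<lambda>b. pi * b\<^sup>2 / s\<^sup>2) has_vector_derivative grid_dist_pdf s x) (at x)"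
      unfolding has_real_derivative_iff_has_vector_derivative[symmetric]
      using s by (auto intro!: derivative_eq_intros simp: field_simps power2_eq_square)
  qed (use s in \<open>auto intro!: continuous_intros\<close>)
  \<comment> \<open>The interior form of the fundamental theorem is essential here: at
    \<open>s/2\<close> the argument of \<open>arccos\<close> is 1 and that of \<open>sqrt\<close> is
    0, and neither function is differentiable there.\<close>
  have I2: "(grid_dist_pdf s has_integral (G b - G (s / 2))) {s/2..b}"
    if "s / 2 \<le> b" "b \<le> s / sqrt 2" for b
  proof (rule fundamental_theorem_of_calculus_interior[OF \<open>s / 2 \<le> b\<close>])
    have pos: "x > 0" "x \<noteq> 0" if "s / 2 \<le> x" for x
      using that s by (smt (verit) half_gt_zero)+
    have "-1 \<le> s / (2 * x)" "s / (2 * x) \<le> 1" if "s / 2 \<le> x" for x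
      using that s pos[OF that] by (auto simp: field_simps)
    then show "continuous_on {s/2..b} G"
      unfolding G_def using s by (intro continuous_intros) (auto dest: pos)
  next
    fix x assume x: "x \<in> {s/2<..<b}"
    then have x0: "x > 0" using s by (smt (verit) half_gt_zero greaterThanLessThan_iff)
    have "s\<^sup>2 < (2 * x)\<^sup>2" using x s by (intro power_strict_mono) auto
    then have pos: "4 * x\<^sup>2 / s\<^sup>2 - 1 > 0" using s by (simp add: field_simps)
    define w where "w = sqrt (4 * x\<^sup>2 / s\<^sup>2 - 1)"
    have w: "w > 0" using pos by (simp add: w_def)
    \<comment> \<open>This factorisation expresses the root in the derivative of
      \<open>arccos\<close> by the \<open>w\<close> that also occurs in the derivative of the root
      term of \<open>G\<close>.\<close>
    have "1 - (s / (2 * x))\<^sup>2 = (s / (2 * x))\<^sup>2 * (4 * x\<^sup>2 / s\<^sup>2 - 1)"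
      using x0 s by (simp add: field_simps)
    then have sq: "sqrt (1 - (s / (2 * x))\<^sup>2) = s / (2 * x) * w"
      using x0 s by (simp add: real_sqrt_mult w_def)
    have lt: "-1 < s / (2 * x)" "s / (2 * x) < 1"
      using x x0 s by (auto simp: field_simps intro: less_trans[of _ 0])
    have d1: "((\<lambda>x. s / (2 * x)) has_real_derivative (- s / (2 * x\<^sup>2))) (at x)"
      using x0 by (auto intro!: derivative_eq_intros simp: field_simps power2_eq_square)
    have d2: "((\<lambda>x. arccos (s / (2 * x))) has_real_derivative
        (inverse (- sqrt (1 - (s / (2 * x))\<^sup>2)) * (- s / (2 * x\<^sup>2)))) (at x)"
      by (rule DERIV_chain2[OF DERIV_arccos d1]) (use lt in auto)
    have d3: "((\<lambda>x. 4 * x\<^sup>2 / s\<^sup>2 - 1) has_real_derivative (8 * x / s\<^sup>2)) (at x)"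
      using s by (auto intro!: derivative_eq_intros simp: field_simps power2_eq_square)
    have d4: "((\<lambda>x. sqrt (4 * x\<^sup>2 / s\<^sup>2 - 1)) has_real_derivative (inverse w / 2 * (8 * x / s\<^sup>2))) (at x)"
      unfolding w_def by (rule DERIV_chain2[OF DERIV_real_sqrt[OF pos] d3])
    have d5: "((\<lambda>x. 2 * (x\<^sup>2 / s\<^sup>2)) has_real_derivative (4 * x / s\<^sup>2)) (at x)"
      using s by (auto intro!: derivative_eq_intros simp: field_simps power2_eq_square)
    define D where "D = inverse (- (s / (2 * x) * w)) * (- s / (2 * x\<^sup>2))"
    have "D = 1 / (x * w)"
      using w s x0 by (simp add: D_def field_simps power2_eq_square)
    have d6: "((\<lambda>x. (pi - 4 * arccos (s / (2 * x))) / 2) has_real_derivative ((0 - 4 * D) / 2)) (at x)"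
      unfolding D_def sq[symmetric] by (intro DERIV_cdivide DERIV_diff DERIV_const DERIV_cmult d2)
    have "(G has_real_derivative
        ((4 * x / s\<^sup>2) * ((pi - 4 * arccos (s / (2 * x))) / 2)
          + ((0 - 4 * D) / 2) * (2 * (x\<^sup>2 / s\<^sup>2)) + inverse w / 2 * (8 * x / s\<^sup>2))) (at x)"
      unfolding G_def by (intro DERIV_add DERIV_mult d4 d5 d6)
    \<comment> \<open>With \<open>D = 1 / (x * w)\<close> the last two summands are
      \<open>- 4 * x / (s\<^sup>2 * w)\<close> and its negative, so only the first one
      survives.\<close>
    moreover have "(4 * x / s\<^sup>2) * ((pi - 4 * arccos (s / (2 * x))) / 2)
          + ((0 - 4 * D) / 2) * (2 * (x\<^sup>2 / s\<^sup>2)) + inverse w / 2 * (8 * x / s\<^sup>2)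
        = grid_dist_pdf s x"
    proof -
      have pdf: "grid_dist_pdf s x = 2 * pi * x / s\<^sup>2 - 8 * x / s\<^sup>2 * arccos (s / (2 * x))"
        using x that by (simp add: grid_dist_pdf_def)
      then show ?thesis
        using s w x0 unfolding \<open>D = 1 / (x * w)\<close> pdf
        by (simp add: field_simps power2_eq_square)
    qed
    ultimately show "(G has_vector_derivative grid_dist_pdf s x) (at x)"
      by (simp add: has_real_derivative_iff_has_vector_derivative)
  qed
  \<comment> \<open>The constant 1 serves as antiderivative; the density need not vanish at the left
    endpoint, since only interior points are tested.\<close>
  have I3: "(grid_dist_pdf s has_integral (1 - 1)) {s / sqrt 2..b}" if "s / sqrt 2 \<le> b" for b
  proof (rule fundamental_theorem_of_calculus_interior[OF that])
    fix x assume "x \<in> {s / sqrt 2<..<b}"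
    then have "s / sqrt 2 < x" by simp
    with half have "\<not> x \<le> s / 2" "\<not> x \<le> s / sqrt 2" by linarith+
    then have "grid_dist_pdf s x = 0" by (simp only: grid_dist_pdf_def simp_thms if_False)
    then show "((\<lambda>_. 1) has_vector_derivative grid_dist_pdf s x) (at x)" by simp
  qed simp
  have G0: "G (s / 2) = pi * (s / 2)\<^sup>2 / s\<^sup>2"
    using s by (simp add: G_def field_simps)
  have G1: "G (s / sqrt 2) = 1"
    using s by (simp add: G_def arccos_sqrt2_half power_divide real_div_sqrt)
  have I12: "(grid_dist_pdf s has_integral G b) {0..b}" if "s / 2 \<le> b" "b \<le> s / sqrt 2" for b
    using has_integral_combine[OF _ that(1) I1[of "s / 2"] I2[OF that]] s by (simp add: G0)
  consider "r \<le> s / 2" | "s / 2 < r" "r \<le> s / sqrt 2" | "s / sqrt 2 < r" by linarith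
  then show ?thesis
  proof cases
    case 1
    then show ?thesis using I1[of r] assms by (simp add: grid_dist_cdf_def)
  next
    case 2
    then show ?thesis using I12[of r] assms by (simp add: grid_dist_cdf_def G_def)
  next
    case 3
    then have "(grid_dist_pdf s has_integral G (s / sqrt 2) + (1 - 1)) {0..r}"
      using half s by (intro has_integral_combine[OF _ _ I12 I3]) auto
    moreover have "\<not> r < 0" "\<not> r \<le> s / 2" "\<not> r \<le> s / sqrt 2"
      using 3 half assms by linarith+
    ultimately show ?thesis by (simp only: grid_dist_cdf_def G1 if_False diff_self add_0_right)
  qed
qed

section \<open>The law of the nearest distance\<close>

text \<open>Nonnegativity of \<open>f\<close> is a separate conjunct because \<open>ennreal\<close>
  sends negative reals to 0 and would hide a sign error in the density.\<close>

theorem lemma1: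
  fixes M :: "'a measure" and U :: "'a \<Rightarrow> real \<times> real"
    and lam s :: real and \<Phi> :: "'a \<Rightarrow> (real \<times> real) set" and R :: "'a \<Rightarrow> real"
  assumes "prob_space M"
    and "lam > 0"
    and "s = 1 / sqrt lam"
    and "U \<in> borel_measurable M"
    and "distr M borel U = uniform_measure lborel (centred_square s)"
    and "\<And>\<omega>. \<Phi> \<omega> = shifted_grid s (U \<omega>)"
    and "\<And>\<omega>. R \<omega> = nearest_dist (\<Phi> \<omega>)"
  defines "f \<equiv> \<lambda>r::real.
      if 0 \<le> r \<and> r \<le> s / 2 then 2 * pi * r / s\<^sup>2
      else if s / 2 < r \<and> r \<le> s / sqrt 2
        then 2 * pi * r / s\<^sup>2 - 8 * r / s\<^sup>2 * arccos (s / (2 * r))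
      else 0"
  shows "(\<forall>r::real. \<P>(\<omega> in M. R \<omega> < r) =
           (if r < 0 then 0
            else if r \<le> s / 2 then pi * r\<^sup>2 / s\<^sup>2
            else if r \<le> s / sqrt 2
              then 2 * (r\<^sup>2 / s\<^sup>2) * ((pi - 4 * arccos (s / (2 * r))) / 2)
                   + sqrt (4 * r\<^sup>2 / s\<^sup>2 - 1)
            else 1))
       \<and> (\<forall>r. 0 \<le> f r) \<and> distributed M lborel R (\<lambda>r. ennreal (f r))"
proof -
  interpret prob_space M by fact
  note [measurable] = \<open>U \<in> borel_measurable M\<close>
  have s: "s > 0" using assms(2,3) by simp
  have R: "R = (\<lambda>\<omega>. nearest_dist (shifted_grid s (U \<omega>)))"
    using assms(6,7) by auto
  have [measurable]: "R \<in> borel_measurable M" unfolding R by measurable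
  have f: "f = grid_dist_pdf s" by (auto simp: f_def grid_dist_pdf_def)
  have [measurable]: "centred_square s \<in> sets borel"
    by (simp add: centred_square_def borel_closed closed_Times)
  \<comment> \<open>The uniform law only sees the square, and there the nearest distance coincides
    with the norm.\<close>
  have prob_R: "emeasure M {\<omega> \<in> space M. R \<omega> \<in> B} =
      emeasure lborel (centred_square s \<inter> norm -` B) / ennreal (s\<^sup>2)" if "B \<in> sets borel" for B
  proof -
    note [measurable] = that
    let ?V = "\<lambda>u. nearest_dist (shifted_grid s u)"
    have V: "?V -` B \<in> sets borel"
      using measurable_sets[OF borel_measurable_nearest_dist that] by simp
    have "emeasure M {\<omega> \<in> space M. R \<omega> \<in> B} = emeasure (distr M borel U) (?V -` B)"
      by (subst emeasure_distr) (use V in \<open>auto simp: R intro!: arg_cong[where f="emeasure M"]\<close>)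
    also have "\<dots> = emeasure lborel (centred_square s \<inter> ?V -` B) / ennreal (s\<^sup>2)"
      using V s by (simp add: assms(5) emeasure_centred_square)
    also have "centred_square s \<inter> ?V -` B = centred_square s \<inter> norm -` B"
      using nearest_dist_shifted_grid[OF s] by auto
    finally show ?thesis .
  qed
  \<comment> \<open>The CDF is an integral of a nonnegative density, so passing through
    \<open>ennreal\<close> loses nothing.\<close>
  have cdf_nonneg: "0 \<le> grid_dist_cdf s r" for r
  proof (cases "r < 0")
    case False
    then show ?thesis
      using has_integral_nonneg[OF has_integral_grid_dist_pdf] grid_dist_pdf_nonneg s by auto
  qed (simp add: grid_dist_cdf_def)
  have cancel: "ennreal (s\<^sup>2 * grid_dist_cdf s r) / ennreal (s\<^sup>2) = ennreal (grid_dist_cdf s r)" for r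
    using s cdf_nonneg[of r] by (simp add: divide_ennreal)
  have le: "emeasure M {\<omega> \<in> space M. R \<omega> \<le> r} = ennreal (grid_dist_cdf s r)" for r
  proof -
    have "norm -` {..r} = cball (0 :: real \<times> real) r" by auto
    then show ?thesis
      using prob_R[of "{..r}"] by (simp add: emeasure_centred_square_Int_cball s cancel)
  qed
  have less: "\<P>(\<omega> in M. R \<omega> < r) = grid_dist_cdf s r" for r
  proof -
    have "norm -` {..<r} = ball (0 :: real \<times> real) r" by auto
    then have "emeasure M {\<omega> \<in> space M. R \<omega> < r} = ennreal (grid_dist_cdf s r)"
      using prob_R[of "{..<r}"]
      by (simp add: emeasure_ball_eq_cball emeasure_centred_square_Int_cball s cancel)
    then show ?thesis using cdf_nonneg[of r] by (simp add: measure_def)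
  qed
  have "distributed M lborel R (\<lambda>r. ennreal (grid_dist_pdf s r))"
  proof (rule distributedI_borel_atMost)
    show "grid_dist_pdf s \<in> borel_measurable borel"
      using s by (rule borel_measurable_grid_dist_pdf)
    show "(\<integral>\<^sup>+x. ennreal (grid_dist_pdf s x * indicator {..r} x) \<partial>lborel) =
        ennreal (grid_dist_cdf s r)" for r
    proof -
      \<comment> \<open>The half-line can be cut down to \<open>{0..r}\<close>, where the integral
        is known.\<close>
      have neg: "grid_dist_pdf s x = 0" if "x < 0" for x
        using that s by (auto simp: grid_dist_pdf_def)
      have "(\<integral>\<^sup>+x. ennreal (grid_dist_pdf s x * indicator {..r} x) \<partial>lborel) =
          (\<integral>\<^sup>+x. ennreal (grid_dist_pdf s x) * indicator {0..r} x \<partial>lborel)"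
        by (intro nn_integral_cong) (auto simp: indicator_def neg)
      also have "\<dots> = ennreal (grid_dist_cdf s r)"
      proof (cases "r < 0")
        case False
        then show ?thesis
          using s by (intro nn_integral_has_integral_lebesgue' has_integral_grid_dist_pdf
              grid_dist_pdf_nonneg) auto
      qed (simp add: grid_dist_cdf_def)
      finally show ?thesis .
    qed
  qed (use le grid_dist_pdf_nonneg[OF s] in auto)
  then show ?thesis
    unfolding f using less grid_dist_pdf_nonneg[OF s] by (simp add: grid_dist_cdf_def)
qed

end
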